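(* There exists an SMC instance with binary valuations for which the set of stable fractional matchings is non-convex.
   Context: An SMC instance is a tuple $\langle M,W,U,V\rangle$ with $n$ men $M$, $n$ women $W$, and $n\times n$ matrices $U,V$ of non-negative rational numbers; $U(m,w)$ is the value of man $m$ for woman $w$ and $V(m,w)$ is the value of woman $w$ for man $m$. Binary valuations means $U,V\in\{0,1\}^{n\times n}$. A fractional matching is $\mu:M\times W\to\mathbb R_{\ge0}$ with $\sum_w\mu(m,w)\le1$ for all $m$ and $\sum_m\mu(m,w)\le1$ for all $w$; it is complete if all these hold with equality. Unless stated otherwise, matchings are assumed complete. Utilities: $u_m(\mu)=\sum_w U(m,w)\mu(m,w)$, $v_w(\mu)=\sum_m V(m,w)\mu(m,w)$. The matching $\mu$ is stable if for every $(m,w)\in M\times W$, $u_m(\mu)\ge U(m,w)$ or $v_w(\mu)\ge V(m,w)$. The set of stable fractional matchings is viewed as a subset of $\mathbb R^{M\times W}$. *)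

theory Defs
  imports "HOL-Analysis.Convex" "HOL-Library.Function_Algebras"
begin

(* The pointwise real vector space structure on functions, so that the library notion
   convex applies to sets of functions. *)

instantiation "fun" :: (type, scaleR) scaleR
begin

definition scaleR_fun :: "real \<Rightarrow> ('a \<Rightarrow> 'b) \<Rightarrow> 'a \<Rightarrow> 'b"
  where "scaleR_fun r f = (\<lambda>x. r *\<^sub>R f x)"

instance ..

end

instance "fun" :: (type, real_vector) real_vector
  by standard
    (simp_all add: scaleR_fun_def plus_fun_def fun_eq_iff scaleR_add_right scaleR_add_left)

record ('m, 'w) smc =
  men :: "'m set"
  women :: "'w set"
  man_value :: "'m \<Rightarrow> 'w \<Rightarrow> rat"
  woman_value :: "'m \<Rightarrow> 'w \<Rightarrow> rat"

(* Values of man_value and woman_value outside men I \<times> women I are unconstrained and never used. *)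

definition smc_instance :: "('m, 'w) smc \<Rightarrow> bool" where
  "smc_instance I \<longleftrightarrow>
     finite (men I) \<and> finite (women I) \<and> card (men I) = card (women I) \<and>
     (\<forall>m\<in>men I. \<forall>w\<in>women I. man_value I m w \<ge> 0 \<and> woman_value I m w \<ge> 0)"

definition binary_valuations :: "('m, 'w) smc \<Rightarrow> bool" where
  "binary_valuations I \<longleftrightarrow>
     (\<forall>m\<in>men I. \<forall>w\<in>women I. man_value I m w \<in> {0, 1} \<and> woman_value I m w \<in> {0, 1})"

(* A function men I \<times> women I \<rightarrow> real is represented by its extension by zero to the whole type,
   so that distinct HOL functions are distinct points of the space of real matrices
   indexed by men I \<times> women I. *)

definition fractional_matching :: "('m, 'w) smc \<Rightarrow> ('m \<times> 'w \<Rightarrow> real) \<Rightarrow> bool" where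
  "fractional_matching I \<mu> \<longleftrightarrow>
     (\<forall>m\<in>men I. \<forall>w\<in>women I. \<mu> (m, w) \<ge> 0) \<and>
     (\<forall>m\<in>men I. (\<Sum>w\<in>women I. \<mu> (m, w)) \<le> 1) \<and>
     (\<forall>w\<in>women I. (\<Sum>m\<in>men I. \<mu> (m, w)) \<le> 1) \<and>
     (\<forall>p. p \<notin> men I \<times> women I \<longrightarrow> \<mu> p = 0)"

definition complete_matching :: "('m, 'w) smc \<Rightarrow> ('m \<times> 'w \<Rightarrow> real) \<Rightarrow> bool" where
  "complete_matching I \<mu> \<longleftrightarrow>
     fractional_matching I \<mu> \<and>
     (\<forall>m\<in>men I. (\<Sum>w\<in>women I. \<mu> (m, w)) = 1) \<and>
     (\<forall>w\<in>women I. (\<Sum>m\<in>men I. \<mu> (m, w)) = 1)"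

definition man_utility :: "('m, 'w) smc \<Rightarrow> ('m \<times> 'w \<Rightarrow> real) \<Rightarrow> 'm \<Rightarrow> real" where
  "man_utility I \<mu> m = (\<Sum>w\<in>women I. of_rat (man_value I m w) * \<mu> (m, w))"

definition woman_utility :: "('m, 'w) smc \<Rightarrow> ('m \<times> 'w \<Rightarrow> real) \<Rightarrow> 'w \<Rightarrow> real" where
  "woman_utility I \<mu> w = (\<Sum>m\<in>men I. of_rat (woman_value I m w) * \<mu> (m, w))"

definition stable :: "('m, 'w) smc \<Rightarrow> ('m \<times> 'w \<Rightarrow> real) \<Rightarrow> bool" where
  "stable I \<mu> \<longleftrightarrow>
     (\<forall>m\<in>men I. \<forall>w\<in>women I.
        man_utility I \<mu> m \<ge> of_rat (man_value I m w) \<or> woman_utility I \<mu> w \<ge> of_rat (woman_value I m w))"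

(* Matchings are complete by convention. *)

definition stable_fractional_matchings :: "('m, 'w) smc \<Rightarrow> ('m \<times> 'w \<Rightarrow> real) set" where
  "stable_fractional_matchings I = {\<mu>. complete_matching I \<mu> \<and> stable I \<mu>}"

end

theory Submission imports Defs begin

text \<open>
  Man 0 values women 0 and 1, woman 0 values men 0 and 1, and all other values are 0, so that
  only the pair (0, 0) can block. One integral stable matching satisfies man 0 alone and another
  satisfies woman 0 alone, so at their midpoint both have utility 1/2 and (0, 0) blocks.
\<close>

theorem proposition3:
  "\<exists>I :: (nat, nat) smc. smc_instance I \<and> binary_valuations I \<and>
     \<not> convex (stable_fractional_matchings I)"
proof -
  \<comment> \<open>Man 2 and woman 2 are the worthless partners: with only two on each side, man 0
    and woman 0 would always have utility 1.\<close>
  define I :: "(nat, nat) smc" where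
    "I = \<lparr>men = {0, 1, 2}, women = {0, 1, 2},
          man_value = (\<lambda>m w. of_bool (m = 0 \<and> w < 2)),
          woman_value = (\<lambda>m w. of_bool (w = 0 \<and> m < 2))\<rparr>"
  \<comment> \<open>\<open>\<mu>\<close> gives man 0 woman 1 and woman 0 the worthless man 2;
    \<open>\<nu>\<close> gives man 0 the worthless woman 2 and woman 0 man 1.\<close>
  define \<mu> \<nu> :: "nat \<times> nat \<Rightarrow> real" where
    "\<mu> = (\<lambda>p. of_bool (p \<in> {(0, 1), (1, 2), (2, 0)}))" and
    "\<nu> = (\<lambda>p. of_bool (p \<in> {(0, 2), (1, 0), (2, 1)}))"
  have "smc_instance I" "binary_valuations I"
    by (auto simp: smc_instance_def binary_valuations_def I_def)
  moreover have "\<not> convex (stable_fractional_matchings I)"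
  proof
    assume conv: "convex (stable_fractional_matchings I)"
    have "\<mu> \<in> stable_fractional_matchings I" "\<nu> \<in> stable_fractional_matchings I"
      by (auto simp: stable_fractional_matchings_def complete_matching_def fractional_matching_def
          stable_def man_utility_def woman_utility_def I_def \<mu>_def \<nu>_def)
    then have "(1/2) *\<^sub>R \<mu> + (1/2) *\<^sub>R \<nu> \<in> stable_fractional_matchings I"
      using conv by (auto intro: convexD)
    then have "stable I ((1/2) *\<^sub>R \<mu> + (1/2) *\<^sub>R \<nu>)"
      by (simp add: stable_fractional_matchings_def)
    \<comment> \<open>In the midpoint, row 0 and column 0 both read 0, 1/2, 1/2, and only the entry
      at index 1 carries value.\<close>
    then show False
      by (simp add: stable_def man_utility_def woman_utility_def I_def \<mu>_def \<nu>_def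
          scaleR_fun_def plus_fun_def)
  qed
  ultimately show ?thesis by blast
qed

end
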